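(* Let $\mathcal Z=\{\bm z\in\mathbb R^{d_{\bm z}}\mid c_\ell(\bm z)\le 0\ \forall \ell\in\mathcal L\}$ be nonempty, where $\mathcal L=\{1,\dots,L\}$ and each $c_\ell:\mathbb R^{d_{\bm z}}\to\overline{\mathbb R}$ is proper, closed and convex. Let $\mathcal I=\{1,\dots,I\}$, $\mathcal I_0=\{0,\dots,I\}$, and for every $i\in\mathcal I_0$ let $f_i:\mathbb R^{d_{\bm x}}\times\mathbb R^{d_{\bm z}}\to\overline{\mathbb R}$ be such that $f_i(\cdot,\bm z)$ is proper, closed and convex for every fixed $\bm z$ and $-f_i(\bm x,\cdot)$ is proper, closed and convex for every fixed $\bm x$. Consider $$\text{(D-B)}\qquad \sup\Big\{-f_0^{*1}(\bm w_0,\bm z_0)-\sum_{i\in\mathcal I}\lambda_i f_i^{*1}(\bm w_i/\lambda_i,\bm z_i)\ \Big|\ \sum_{i\in\mathcal I_0}\bm w_i=\bm 0,\ \bm w_i\in\mathbb R^{d_{\bm x}},\ \bm z_i\in\mathcal Z\ \forall i\in\mathcal I_0,\ \bm\lambda\in\mathbb R^I,\ \bm\lambda\ge\bm 0\Big\}$$ and $$\text{(D-B}'\text{)}\qquad\begin{array}{cl}\sup & -f_0^{*1}(\bm w_0,\bm z_0)-\sum_{i\in\mathcal I}\lambda_i f_i^{*1}(\bm w_i/\lambda_i,\bm\upsilon_i/\lambda_i)\\ \text{s.t.}&\sum_{i\in\mathcal I_0}\bm w_i=\bm 0\\ & c_\ell(\bm z_0)\le 0\quad\forall\ell\in\mathcal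 L\\ & \lambda_i c_\ell(\bm\upsilon_i/\lambda_i)\le 0\quad\forall i\in\mathcal I,\ \forall\ell\in\mathcal L\\ & \bm w_i\in\mathbb R^{d_{\bm x}}\ (i\in\mathcal I_0),\ \bm z_0\in\mathbb R^{d_{\bm z}},\ \bm\lambda\in\mathbb R^I,\ \bm\lambda\ge\bm 0,\ \bm\upsilon_i\in\mathbb R^{d_{\bm z}}\ (i\in\mathcal I).\end{array}$$ Then the following hold. (i) The supremum of (D-B) is smaller than or equal to that of (D-B$'$). (ii) If (D-B) admits a strict Slater point, then the suprema of (D-B) and (D-B$'$) coincide, and (D-B$'$) is solvable whenever (D-B) is solvable. (iii) If $\mathcal Z$ is bounded, then the suprema of (D-B) and (D-B$'$) coincide, and (D-B$'$) is solvable if and only if (D-B) is solvable.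
   Context: $\overline{\mathbb R}=[-\infty,+\infty]$. For $f:\mathbb R^d\to\overline{\mathbb R}$: $\mathrm{dom}(f)=\{\bm x\mid f(\bm x)<+\infty\}$; $f$ is proper if $f>-\infty$ everywhere and $\mathrm{dom}(f)\ne\emptyset$; $f$ is closed if it is lower semicontinuous and either $f>-\infty$ everywhere or $f\equiv-\infty$; $f^*(\bm w)=\sup_{\bm x}\{\bm w^\top\bm x-f(\bm x)\}$. The support function of a set $\mathcal X$ is $\delta^*_{\mathcal X}(\bm w)=\sup_{\bm x\in\mathcal X}\bm x^\top\bm w$. Partial conjugate: $f^{*1}(\bm w,\bm z)=\sup_{\bm x}\{\bm w^\top\bm x-f(\bm x,\bm z)\}$. Perspectives: for $f$ proper, closed and convex, $tf(\bm x/t)$ has its usual meaning for $t>0$, and for $t=0$ it denotes $\delta^*_{\mathrm{dom}(f^* )}(\bm x)$. In (D-B$'$) the expressions $\lambda_ic_\ell(\bm\upsilon_i/\lambda_i)$ and $\lambda_if_i^{*1}(\bm w_i/\lambda_i,\bm\upsilon_i/\lambda_i)$ are perspectives in this sense, the latter of $f_i^{*1}$ jointly in both arguments, so that its value at $\lambda_i=0$ is $\delta^*_{\mathrm{dom}((f_i^{*1})^* )}(\bm w_i,\bm\upsilon_i)$. In (D-B), $\lambda_if_i^{*1}(\bm w_i/\lambda_i,\bm z_i)$ is the partial perspective with respect to the first argument, whose value at $\lambda_i=0$ is $\delta^*_{\mathrm{dom}((f_i^{*1})^{*1}(\cdot,\bm z_i))}(\bm w_i)=\delta^*_{\mathrm{dom}(f_i(\cdot,\bm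 z_i))}(\bm w_i)$. Perspectives are defined for $t\ge0$ and regarded as $+\infty$ for $t<0$ when their domains are considered. Optimization conventions: a solution (any assignment of real values to the decision variables) is feasible if it satisfies all constraints and its objective value is not $+\infty$ (minimization) or not $-\infty$ (maximization). A feasible problem is solvable if its optimal value is attained by a feasible solution; an infeasible problem is regarded as solved by any solution (hence solvable), and its optimal value is $+\infty$ (minimization) or $-\infty$ (maximization). Slater points: let $\mathcal X=\{\bm x\mid g_i(\bm x)\le 0\ \forall i,\ h_j(\bm x)=0\ \forall j\}$ be a set with this given representation. $\bm x^{\rm S}$ is a Slater point of $\mathcal X$ if (a) it lies in $\mathrm{ri}(\mathrm{dom}(g_i))$ and $\mathrm{ri}(\mathrm{dom}(h_j))$ for all $i,j$, (b) $\bm x^{\rm S}\in\mathcal X$, and (c) $g_i(\bm x^{\rm S})<0$ for all $i$ such that $g_i$ is nonlinear (i.e. not affine). It is strict if $g_i(\bm x^{\rm S})<0$ for all $i$. A (strict) Slater point of the maximization problem $\sup\{g_0(\bm x)\mid\bm x\in\mathcal X\}$ is a (strict) Slater point of $\mathcal X$ that lies in $\mathrm{ri}(\mathrm{dom}(-g_0))$. Here $\mathrm{ri}$ denotes relative interior (interior relative to the affine hull). In (D-B) the inequality constraints are $c_\ell(\bm z_i)\le0$ ($i\in\mathcal I_0$, $\ell\in\mathcal L$) and $-\lambda_i\le 0$ ($i\in\mathcal I$). *)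

theory Defs
  imports "HOL-Analysis.Analysis"
begin

section \<open>Extended-real-valued functions\<close>

definition edom :: "('a \<Rightarrow> ereal) \<Rightarrow> 'a set" where
  "edom f = {x. f x < \<infinity>}"

definition proper_fun :: "('a \<Rightarrow> ereal) \<Rightarrow> bool" where
  "proper_fun f \<longleftrightarrow> (\<forall>x. f x > -\<infinity>) \<and> edom f \<noteq> {}"

definition lsc_fun :: "('a::topological_space \<Rightarrow> ereal) \<Rightarrow> bool" where
  "lsc_fun f \<longleftrightarrow> (\<forall>x. f x \<le> Liminf (at x) f)"

definition closed_fun :: "('a::topological_space \<Rightarrow> ereal) \<Rightarrow> bool" where
  "closed_fun f \<longleftrightarrow> lsc_fun f \<and> ((\<forall>x. f x > -\<infinity>) \<or> (\<forall>x. f x = -\<infinity>))"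

text \<open>Convexity of the epigraph, so that no sum of opposite infinities occurs.\<close>

definition convex_fun :: "('a::real_vector \<Rightarrow> ereal) \<Rightarrow> bool" where
  "convex_fun f \<longleftrightarrow> convex {(x, r::real). f x \<le> ereal r}"

definition affine_fun :: "('a::real_inner \<Rightarrow> ereal) \<Rightarrow> bool" where
  "affine_fun f \<longleftrightarrow> (\<exists>a b. \<forall>x. f x = ereal (a \<bullet> x + b))"

definition conjugate :: "('a::real_inner \<Rightarrow> ereal) \<Rightarrow> 'a \<Rightarrow> ereal" where
  "conjugate f w = (SUP x. ereal (w \<bullet> x) - f x)"

definition support_fun :: "'a::real_inner set \<Rightarrow> 'a \<Rightarrow> ereal" where
  "support_fun X w = (SUP x\<in>X. ereal (x \<bullet> w))"

definition partial_conjugate :: "('a::real_inner \<times> 'b \<Rightarrow> ereal) \<Rightarrow> 'a \<times> 'b \<Rightarrow> ereal" where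
  "partial_conjugate f = (\<lambda>(w, z). SUP x. ereal (w \<bullet> x) - f (x, z))"

text \<open>\<open>perspective f t x\<close> is \<open>t f(x/t)\<close>. The partial perspective of \<open>g\<close> with respect to its
  first argument is \<open>perspective (\<lambda>w. g (w, z)) t w\<close>, the joint one is
  \<open>perspective g t (w, z)\<close>.\<close>

definition perspective :: "('a::real_inner \<Rightarrow> ereal) \<Rightarrow> real \<Rightarrow> 'a \<Rightarrow> ereal" where
  "perspective f t x =
    (if t > 0 then ereal t * f (x /\<^sub>R t)
     else if t = 0 then support_fun (edom (conjugate f)) x
     else \<infinity>)"

section \<open>Maximization problems and Slater points\<close>

definition max_feasible :: "('x \<Rightarrow> ereal) \<Rightarrow> 'x set \<Rightarrow> 'x set" where
  "max_feasible g X = {x \<in> X. g x \<noteq> -\<infinity>}"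

text \<open>The supremum is \<open>-\<infinity>\<close> for infeasible problems, since \<open>Sup {} = -\<infinity>\<close> in \<^typ>\<open>ereal\<close>.\<close>

definition max_value :: "('x \<Rightarrow> ereal) \<Rightarrow> 'x set \<Rightarrow> ereal" where
  "max_value g X = (SUP x\<in>X. g x)"

definition max_solvable :: "('x \<Rightarrow> ereal) \<Rightarrow> 'x set \<Rightarrow> bool" where
  "max_solvable g X \<longleftrightarrow>
    max_feasible g X = {} \<or> (\<exists>x\<in>max_feasible g X. g x = max_value g X)"

text \<open>A represented set is given by the set \<open>G\<close> of its inequality constraint functions and
  the set \<open>H\<close> of its equality constraint functions.\<close>

definition constraint_set :: "('x \<Rightarrow> ereal) set \<Rightarrow> ('x \<Rightarrow> ereal) set \<Rightarrow> 'x set" where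
  "constraint_set G H = {x. (\<forall>g\<in>G. g x \<le> 0) \<and> (\<forall>h\<in>H. h x = 0)}"

definition slater_point ::
  "('x::euclidean_space \<Rightarrow> ereal) set \<Rightarrow> ('x \<Rightarrow> ereal) set \<Rightarrow> 'x \<Rightarrow> bool" where
  "slater_point G H x \<longleftrightarrow>
    (\<forall>g\<in>G. x \<in> rel_interior (edom g)) \<and> (\<forall>h\<in>H. x \<in> rel_interior (edom h)) \<and>
    x \<in> constraint_set G H \<and>
    (\<forall>g\<in>G. \<not> affine_fun g \<longrightarrow> g x < 0)"

definition strict_slater_point ::
  "('x::euclidean_space \<Rightarrow> ereal) set \<Rightarrow> ('x \<Rightarrow> ereal) set \<Rightarrow> 'x \<Rightarrow> bool" where
  "strict_slater_point G H x \<longleftrightarrow> slater_point G H x \<and> (\<forall>g\<in>G. g x < 0)"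

definition max_strict_slater_point ::
  "('x::euclidean_space \<Rightarrow> ereal) \<Rightarrow> ('x \<Rightarrow> ereal) set \<Rightarrow> ('x \<Rightarrow> ereal) set \<Rightarrow> 'x \<Rightarrow> bool" where
  "max_strict_slater_point g\<^sub>0 G H x \<longleftrightarrow>
    strict_slater_point G H x \<and> x \<in> rel_interior (edom (\<lambda>y. - g\<^sub>0 y))"

section \<open>The two dual problems\<close>

text \<open>The finite type \<open>'i\<close> is the index set \<open>{1..I}\<close>, and \<open>'i option\<close> is \<open>{0..I}\<close>, with
  \<open>None\<close> in the role of \<open>0\<close> and \<open>Some i\<close> in the role of \<open>i\<close>.\<close>

definition uncertainty_set :: "nat \<Rightarrow> (nat \<Rightarrow> 'b \<Rightarrow> ereal) \<Rightarrow> 'b set" where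
  "uncertainty_set L c = {z. \<forall>l\<in>{1..L}. c l z \<le> 0}"

text \<open>Decision variables \<open>(w, z, \<lambda>)\<close>.\<close>

type_synonym ('a, 'b, 'i) DB_var = "('a ^ 'i option) \<times> ('b ^ 'i option) \<times> (real ^ 'i)"

definition DB_obj ::
  "('i::finite option \<Rightarrow> 'a::euclidean_space \<times> 'b::euclidean_space \<Rightarrow> ereal) \<Rightarrow>
    ('a, 'b, 'i) DB_var \<Rightarrow> ereal" where
  "DB_obj f = (\<lambda>(w, z, lam).
     - partial_conjugate (f None) (w $ None, z $ None)
     - (\<Sum>i\<in>UNIV. perspective (\<lambda>u. partial_conjugate (f (Some i)) (u, z $ Some i))
                        (lam $ i) (w $ Some i)))"

definition DB_set ::
  "nat \<Rightarrow> (nat \<Rightarrow> 'b \<Rightarrow> ereal) \<Rightarrow>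
    ('a::euclidean_space, 'b::euclidean_space, 'i::finite) DB_var set" where
  "DB_set L c = {(w, z, lam).
     (\<Sum>i\<in>UNIV. w $ i) = 0 \<and> (\<forall>i. z $ i \<in> uncertainty_set L c) \<and> (\<forall>i. lam $ i \<ge> 0)}"

definition DB_ineqs ::
  "nat \<Rightarrow> (nat \<Rightarrow> 'b \<Rightarrow> ereal) \<Rightarrow>
    (('a::euclidean_space, 'b::euclidean_space, 'i::finite) DB_var \<Rightarrow> ereal) set" where
  "DB_ineqs L c =
     {\<lambda>(w, z, lam). c l (z $ i) | i l. l \<in> {1..L}} \<union>
     {\<lambda>(w, z, lam). ereal (- (lam $ i)) | i. True}"

text \<open>The vector equation \<open>\<Sum>\<^sub>i w\<^sub>i = 0\<close>, coordinate by coordinate.\<close>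

definition DB_eqs ::
  "(('a::euclidean_space, 'b::euclidean_space, 'i::finite) DB_var \<Rightarrow> ereal) set" where
  "DB_eqs = {\<lambda>(w, z, lam). ereal ((\<Sum>i\<in>UNIV. w $ i) \<bullet> b) | b. b \<in> Basis}"

lemma DB_set_eq_constraint_set:
  "(DB_set L c :: ('a::euclidean_space, 'b::euclidean_space, 'i::finite) DB_var set)
    = constraint_set (DB_ineqs L c) DB_eqs"
proof (rule set_eqI)
  fix x :: "('a, 'b, 'i) DB_var"
  obtain w z lam where x: "x = (w, z, lam)"
    by (cases x)
  have ineqs: "(\<forall>g\<in>DB_ineqs L c. g x \<le> 0) \<longleftrightarrow>
      (\<forall>i. \<forall>l\<in>{1..L}. c l (z $ i) \<le> 0) \<and> (\<forall>i. ereal (- (lam $ i)) \<le> 0)"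
    unfolding DB_ineqs_def x ball_Un
    by (intro arg_cong2 [where f = "(\<and>)"]; force)
  have "(\<forall>h\<in>DB_eqs. h x = 0) \<longleftrightarrow> (\<forall>b\<in>Basis. ereal ((\<Sum>i\<in>UNIV. w $ i) \<bullet> b) = 0)"
    unfolding DB_eqs_def x by force
  also have "\<dots> \<longleftrightarrow> (\<Sum>i\<in>UNIV. w $ i) = 0"
    unfolding zero_ereal_def ereal.inject by (rule euclidean_all_zero_iff)
  finally have eqs: "(\<forall>h\<in>DB_eqs. h x = 0) \<longleftrightarrow> (\<Sum>i\<in>UNIV. w $ i) = 0" .
  show "x \<in> DB_set L c \<longleftrightarrow> x \<in> constraint_set (DB_ineqs L c) DB_eqs"
    unfolding constraint_set_def mem_Collect_eq ineqs eqs
    by (auto simp: x DB_set_def uncertainty_set_def zero_ereal_def)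
qed

text \<open>Decision variables \<open>(w, z\<^sub>0, \<lambda>, \<upsilon>)\<close>.\<close>

type_synonym ('a, 'b, 'i) DB'_var = "('a ^ 'i option) \<times> 'b \<times> (real ^ 'i) \<times> ('b ^ 'i)"

definition DB'_obj ::
  "('i::finite option \<Rightarrow> 'a::euclidean_space \<times> 'b::euclidean_space \<Rightarrow> ereal) \<Rightarrow>
    ('a, 'b, 'i) DB'_var \<Rightarrow> ereal" where
  "DB'_obj f = (\<lambda>(w, z\<^sub>0, lam, v).
     - partial_conjugate (f None) (w $ None, z\<^sub>0)
     - (\<Sum>i\<in>UNIV. perspective (partial_conjugate (f (Some i))) (lam $ i) (w $ Some i, v $ i)))"

definition DB'_set ::
  "nat \<Rightarrow> (nat \<Rightarrow> 'b \<Rightarrow> ereal) \<Rightarrow>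
    ('a::euclidean_space, 'b::euclidean_space, 'i::finite) DB'_var set" where
  "DB'_set L c = {(w, z\<^sub>0, lam, v).
     (\<Sum>i\<in>UNIV. w $ i) = 0 \<and>
     (\<forall>l\<in>{1..L}. c l z\<^sub>0 \<le> 0) \<and>
     (\<forall>i. \<forall>l\<in>{1..L}. perspective (c l) (lam $ i) (v $ i) \<le> 0) \<and>
     (\<forall>i. lam $ i \<ge> 0)}"

end

theory Submission
  imports Defs
begin

text \<open>Both properness assumptions together force every \<open>f\<^sub>i\<close> to be finite, so \<open>f\<^sub>i\<^sup>*\<^sup>1\<close> is a jointly
  closed proper convex function. By the Fenchel--Moreau theorem, the perspective of such a function
  \<open>g\<close> is \<open>t g(x/t) = sup {y \<bullet> x - t g\<^sup>*(y) | y \<in> dom g\<^sup>*}\<close> for all \<open>t \<ge> 0\<close>, including \<open>t = 0\<close>;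
  it is therefore jointly convex in \<open>(t, x)\<close>, and (D-B\<open>'\<close>) is a concave problem. The substitution
  \<open>\<upsilon>\<^sub>i = \<lambda>\<^sub>i z\<^sub>i\<close> embeds (D-B) into (D-B\<open>'\<close>), and its image consists of the points with
  \<open>\<upsilon>\<^sub>i = 0\<close> whenever \<open>\<lambda>\<^sub>i = 0\<close>. If \<open>Z\<close> is bounded this is no restriction, because \<open>\<lambda>\<^sub>i = 0\<close> forces
  \<open>\<upsilon>\<^sub>i\<close> to be a recession direction of \<open>Z\<close>. In the Slater case every point of (D-B\<open>'\<close>) is a limit of
  convex combinations with the image of the Slater point, which have \<open>\<lambda> > 0\<close>.\<close>

section \<open>Closed proper convex functions\<close>

text \<open>Lower semicontinuity is recorded as closedness of the epigraph, a form ready for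
  hyperplane separation and stable under intersections.\<close>

definition closed_epigraph_fun :: "('a::euclidean_space \<Rightarrow> ereal) \<Rightarrow> bool" where
  "closed_epigraph_fun f \<longleftrightarrow>
    proper_fun f \<and> convex_fun f \<and> closed {(x, r::real). f x \<le> ereal r}"

text \<open>If a limit \<open>(x, r)\<close> had \<open>f x > r\<close>, a real \<open>s\<close>
  strictly between would bound \<open>f\<close> from below near \<open>x\<close>, while the heights
  in the sequence drop below \<open>s\<close>.\<close>

lemma lsc_fun_closed_epigraph:
  fixes f :: "'a::euclidean_space \<Rightarrow> ereal"
  assumes "lsc_fun f"
  shows "closed {(x, r::real). f x \<le> ereal r}"
  unfolding closed_sequential_limits
proof (intro allI impI, elim conjE)
  fix X :: "nat \<Rightarrow> 'a \<times> real" and l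
  assume mem: "\<forall>n. X n \<in> {(x, r). f x \<le> ereal r}" and lim: "X \<longlonglongrightarrow> l"
  obtain x r where l: "l = (x, r)" by (cases l)
  have lim1: "(\<lambda>n. fst (X n)) \<longlonglongrightarrow> x" and lim2: "(\<lambda>n. snd (X n)) \<longlonglongrightarrow> r"
    using tendsto_fst[OF lim] tendsto_snd[OF lim] by (auto simp: l)
  have "f x \<le> ereal r"
  proof (rule ccontr)
    assume "\<not> f x \<le> ereal r"
    then obtain s where s: "ereal r < ereal s" "ereal s < f x"
      using ereal_dense2[of "ereal r" "f x"] by (auto simp: not_le)
    have "ereal s < Liminf (at x) f"
      using s assms unfolding lsc_fun_def by (meson less_le_trans)
    then have "\<forall>\<^sub>F y in at x. ereal s < f y" by (rule less_LiminfD)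
    \<comment> \<open>The filter \<open>at x\<close> omits \<open>x\<close> itself, where the bound
      holds by the choice of \<open>s\<close>.\<close>
    then have "\<forall>\<^sub>F y in nhds x. ereal s < f y"
      unfolding eventually_at_filter by (rule eventually_mono) (use s in auto)
    then have "\<forall>\<^sub>F n in sequentially. ereal s < f (fst (X n))"
      using lim1 by (rule eventually_compose_filterlim)
    moreover have "\<forall>\<^sub>F n in sequentially. snd (X n) < s"
      using order_tendstoD(2)[OF lim2] s by simp
    ultimately have "\<forall>\<^sub>F n in sequentially. False"
    proof eventually_elim
      case (elim n)
      have "f (fst (X n)) \<le> ereal (snd (X n))"
        using mem by (auto simp: case_prod_beta)
      also have "\<dots> < ereal s" using elim by simp
      finally show ?case using elim by simp
    qed
    then show False by simp
  qed
  then show "l \<in> {(x, r). f x \<le> ereal r}" by (simp add: l)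
qed

lemma closed_epigraph_funI:
  "proper_fun f \<Longrightarrow> closed_fun f \<Longrightarrow> convex_fun f \<Longrightarrow> closed_epigraph_fun f"
  by (auto simp: closed_epigraph_fun_def closed_fun_def intro: lsc_fun_closed_epigraph)

text \<open>A point below the graph is separated strictly from the closed convex epigraph. The
  height coefficient \<open>\<alpha>\<close> cannot be negative because the epigraph is unbounded
  upwards.\<close>

lemma epigraph_separation:
  fixes f :: "'a::euclidean_space \<Rightarrow> ereal"
  assumes f: "closed_epigraph_fun f" and r: "ereal r < f x"
  obtains a \<alpha> \<beta> where "a \<bullet> x + \<alpha> * r < \<beta>" "\<alpha> \<ge> 0"
    "\<And>u s. f u \<le> ereal s \<Longrightarrow> \<beta> < a \<bullet> u + \<alpha> * s"
proof -
  let ?E = "{(x, r::real). f x \<le> ereal r}"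
  have "\<exists>p \<beta>. p \<bullet> (x, r) < \<beta> \<and> (\<forall>q\<in>?E. p \<bullet> q > \<beta>)"
    using f r by (intro separating_hyperplane_closed_point)
      (auto simp: closed_epigraph_fun_def convex_fun_def)
  then obtain a \<alpha> \<beta> where *: "(a, \<alpha>) \<bullet> (x, r) < \<beta>" "\<And>q. q \<in> ?E \<Longrightarrow> (a, \<alpha>) \<bullet> q > \<beta>"
    by (metis surj_pair)
  have sep: "\<beta> < a \<bullet> u + \<alpha> * s" if "f u \<le> ereal s" for u s
    using *(2)[of "(u, s)"] that by simp
  obtain u where "f u < \<infinity>" "f u > -\<infinity>"
    using f by (auto simp: closed_epigraph_fun_def proper_fun_def edom_def)
  then obtain m where m: "f u = ereal m" by (cases "f u") auto
  have "\<alpha> \<ge> 0"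
  proof (rule ccontr)
    assume neg: "\<not> \<alpha> \<ge> 0"
    \<comment> \<open>Since \<open>?s\<close> is at least \<open>m\<close>, the point
      \<open>(u, ?s)\<close> is in the epigraph; it is also high enough to violate the separation
      when \<open>\<alpha>\<close> is negative.\<close>
    let ?s = "max m ((\<beta> - a \<bullet> u) / \<alpha>)"
    have "\<beta> < a \<bullet> u + \<alpha> * ?s" by (rule sep) (simp add: m)
    moreover have "\<alpha> * ?s \<le> \<alpha> * ((\<beta> - a \<bullet> u) / \<alpha>)"
      using neg by (intro mult_left_mono_neg) auto
    ultimately show False using neg by simp
  qed
  with * sep show thesis using that by simp
qed

lemma affine_minorant_nonvertical:
  fixes f :: "'a::euclidean_space \<Rightarrow> ereal"
  assumes "\<alpha> > 0" and sep: "\<And>u s. f u \<le> ereal s \<Longrightarrow> \<beta> < a \<bullet> u + \<alpha> * s"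
  shows "ereal ((- a /\<^sub>R \<alpha>) \<bullet> u + \<beta> / \<alpha>) \<le> f u"
proof (rule ereal_le_real)
  fix s assume "f u \<le> ereal s"
  then have "\<beta> < a \<bullet> u + \<alpha> * s" by (rule sep)
  then show "ereal ((- a /\<^sub>R \<alpha>) \<bullet> u + \<beta> / \<alpha>) \<le> ereal s"
    using \<open>\<alpha> > 0\<close> by (simp add: field_simps)
qed

text \<open>The core of Fenchel-Moreau: \<open>f\<close> is the supremum of its affine minorants. A
  nonvertical separating hyperplane is the graph of such a minorant; a vertical one is used by
  adding a large multiple of its equation to some minorant.\<close>

lemma affine_minorant_above:
  fixes f :: "'a::euclidean_space \<Rightarrow> ereal"
  assumes f: "closed_epigraph_fun f" and r: "ereal r < f x"
  obtains y b where "\<And>u. ereal (y \<bullet> u + b) \<le> f u" "r < y \<bullet> x + b"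
proof -
  obtain a \<alpha> \<beta> where 1: "a \<bullet> x + \<alpha> * r < \<beta>" "\<alpha> \<ge> 0"
    "\<And>u s. f u \<le> ereal s \<Longrightarrow> \<beta> < a \<bullet> u + \<alpha> * s"
    using epigraph_separation[OF f r] by blast
  show thesis
  proof (cases "\<alpha> = 0")
    case False
    with 1 have "\<alpha> > 0" by simp
    moreover have "r < (- a /\<^sub>R \<alpha>) \<bullet> x + \<beta> / \<alpha>"
      using 1(1) \<open>\<alpha> > 0\<close> by (simp add: field_simps)
    ultimately show thesis
      using that affine_minorant_nonvertical[of \<alpha> f \<beta> a] 1(3) by blast
  next
    case True
    obtain x1 where "f x1 < \<infinity>" "f x1 > -\<infinity>"
      using f by (auto simp: closed_epigraph_fun_def proper_fun_def edom_def)
    then obtain m where m: "f x1 = ereal m" by (cases "f x1") auto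
    have "ereal (m - 1) < f x1" by (simp add: m)
    then obtain a' \<alpha>' \<beta>' where 2: "a' \<bullet> x1 + \<alpha>' * (m - 1) < \<beta>'" "\<alpha>' \<ge> 0"
      "\<And>u s. f u \<le> ereal s \<Longrightarrow> \<beta>' < a' \<bullet> u + \<alpha>' * s"
      using epigraph_separation[OF f] by blast
    \<comment> \<open>The points \<open>(x1, m - 1)\<close> and \<open>(x1, m)\<close> lie on one
      vertical line, so no vertical hyperplane separates them.\<close>
    have "\<alpha>' \<noteq> 0" using 2(1) 2(3)[of x1 m] m by auto
    then obtain y b where yb: "\<And>u. ereal (y \<bullet> u + b) \<le> f u"
      using affine_minorant_nonvertical[of \<alpha>' f \<beta>' a'] 2 by (metis less_eq_real_def)
    \<comment> \<open>The affine function \<open>\<beta> - a \<bullet> u\<close> is negative on the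
      domain of \<open>f\<close> and positive at \<open>x\<close>. As \<open>k\<close> is
      nonnegative, adding \<open>k\<close> times it keeps a minorant; \<open>k\<close> is large
      enough to lift the value at \<open>x\<close> above \<open>r\<close>.\<close>
    define k where "k = max 0 ((r - y \<bullet> x - b) / (\<beta> - a \<bullet> x) + 1)"
    have gap: "\<beta> - a \<bullet> x > 0" using 1 True by simp
    have "(r - y \<bullet> x - b) / (\<beta> - a \<bullet> x) < k" by (simp add: k_def)
    then have k: "r - y \<bullet> x - b < k * (\<beta> - a \<bullet> x)" using gap by (simp add: field_simps)
    show thesis
    proof (rule that)
      show "r < (y - k *\<^sub>R a) \<bullet> x + (b + k * \<beta>)"
        using k by (simp add: inner_diff_left algebra_simps)
      show "ereal ((y - k *\<^sub>R a) \<bullet> u + (b + k * \<beta>)) \<le> f u" for u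
      proof (rule ereal_le_real)
        fix s assume s: "f u \<le> ereal s"
        then have "y \<bullet> u + b \<le> s"
          using yb[of u] order_trans by (metis ereal_less_eq(3))
        moreover have "k * \<beta> \<le> k * (a \<bullet> u)"
          using 1(3)[OF s] True by (intro mult_left_mono) (auto simp: k_def)
        ultimately show "ereal ((y - k *\<^sub>R a) \<bullet> u + (b + k * \<beta>)) \<le> ereal s"
          by (simp add: inner_diff_left)
      qed
    qed
  qed
qed

section \<open>Conjugates and perspectives\<close>

lemma conjugate_le_iff:
  assumes "\<And>x. f x > -\<infinity>"
  shows "conjugate f y \<le> ereal b \<longleftrightarrow> (\<forall>x. ereal (y \<bullet> x - b) \<le> f x)"
proof -
  have "ereal (y \<bullet> x) - f x \<le> ereal b \<longleftrightarrow> ereal (y \<bullet> x - b) \<le> f x" for x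
    using assms[of x] by (cases "f x") auto
  then show ?thesis by (simp add: conjugate_def SUP_le_iff)
qed

lemma conjugate_gt_MInf:
  assumes "proper_fun f"
  shows "conjugate f y > -\<infinity>"
proof -
  obtain u where "f u < \<infinity>" "f u > -\<infinity>"
    using assms by (auto simp: proper_fun_def edom_def)
  then have "-\<infinity> < ereal (y \<bullet> u) - f u" by (cases "f u") auto
  also have "\<dots> \<le> conjugate f y" unfolding conjugate_def by (rule SUP_upper) simp
  finally show ?thesis .
qed

lemma edom_conjugateE:
  assumes "proper_fun f" "y \<in> edom (conjugate f)"
  obtains b where "conjugate f y = ereal b"
  using assms conjugate_gt_MInf[OF assms(1), of y]
  by (cases "conjugate f y") (auto simp: edom_def)

lemma edom_conjugateI:
  assumes "\<And>x. f x > -\<infinity>" "\<And>x. ereal (y \<bullet> x + b) \<le> f x"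
  shows "y \<in> edom (conjugate f)"
proof -
  have "conjugate f y \<le> ereal (- b)"
    using assms by (subst conjugate_le_iff) auto
  then show ?thesis by (auto simp: edom_def less_le_trans)
qed

lemma edom_conjugate_nonempty:
  assumes "closed_epigraph_fun f"
  shows "edom (conjugate f) \<noteq> {}"
proof -
  have gt: "f x > -\<infinity>" for x using assms by (auto simp: closed_epigraph_fun_def proper_fun_def)
  obtain r where "ereal r < f 0" using gt[of 0] ereal_dense2 by blast
  then obtain y b where "\<And>u. ereal (y \<bullet> u + b) \<le> f u"
    using affine_minorant_above[OF assms] by metis
  then show ?thesis using edom_conjugateI gt by blast
qed

text \<open>The Fenchel--Moreau theorem \<open>f = f\<^sup>*\<^sup>*\<close>, on real sublevels.\<close>

lemma biconjugate_le_iff: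
  fixes f :: "'a::euclidean_space \<Rightarrow> ereal"
  assumes f: "closed_epigraph_fun f"
  shows "f x \<le> ereal r \<longleftrightarrow>
    (\<forall>y\<in>edom (conjugate f). y \<bullet> x - real_of_ereal (conjugate f y) \<le> r)"
proof
  have proper: "proper_fun f" and gt: "\<And>x. f x > -\<infinity>"
    using f by (auto simp: closed_epigraph_fun_def proper_fun_def)
  {
    assume le: "f x \<le> ereal r"
    show "\<forall>y\<in>edom (conjugate f). y \<bullet> x - real_of_ereal (conjugate f y) \<le> r"
    proof
      fix y assume "y \<in> edom (conjugate f)"
      then obtain b where b: "conjugate f y = ereal b"
        using edom_conjugateE proper by blast
      then have "ereal (y \<bullet> x - b) \<le> f x" using conjugate_le_iff[of f y b] gt by simp
      then have "ereal (y \<bullet> x - b) \<le> ereal r" using le by (rule order_trans)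
      then show "y \<bullet> x - real_of_ereal (conjugate f y) \<le> r" by (simp add: b)
    qed
  next
    assume all: "\<forall>y\<in>edom (conjugate f). y \<bullet> x - real_of_ereal (conjugate f y) \<le> r"
    show "f x \<le> ereal r"
    proof (rule ccontr)
      assume "\<not> f x \<le> ereal r"
      then have "ereal r < f x" by simp
      then obtain y b where yb: "\<And>u. ereal (y \<bullet> u + b) \<le> f u" "r < y \<bullet> x + b"
        using affine_minorant_above[OF f] by blast
      have y: "y \<in> edom (conjugate f)" using edom_conjugateI yb gt by blast
      then obtain d where d: "conjugate f y = ereal d"
        using edom_conjugateE proper by blast
      \<comment> \<open>A minorant with slope \<open>y\<close> and intercept \<open>b\<close> bounds
        the conjugate at \<open>y\<close> by \<open>- b\<close>, so \<open>y\<close> violates the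
        assumed inequality.\<close>
      have "conjugate f y \<le> ereal (- b)" using gt yb by (subst conjugate_le_iff) auto
      then show False using d all y yb(2) by force
    qed
  }
qed

text \<open>For \<open>t > 0\<close> this is the biconjugate formula at
  \<open>x /\<^sub>R t\<close>, multiplied by \<open>t\<close>; for \<open>t = 0\<close> it is the
  support function. One family of inequalities, each linear in \<open>(t, x, r)\<close>, covers both
  cases.\<close>

lemma perspective_le_iff:
  fixes f :: "'a::euclidean_space \<Rightarrow> ereal"
  assumes f: "closed_epigraph_fun f" and t: "t \<ge> 0"
  shows "perspective f t x \<le> ereal r \<longleftrightarrow>
    (\<forall>y\<in>edom (conjugate f). y \<bullet> x - t * real_of_ereal (conjugate f y) \<le> r)"
proof (cases "t = 0")
  case True
  then show ?thesis by (simp add: perspective_def support_fun_def SUP_le_iff)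
next
  case False
  then have t: "t > 0" using t by simp
  have "perspective f t x \<le> ereal r \<longleftrightarrow> f (x /\<^sub>R t) \<le> ereal (r / t)"
    using t by (cases "f (x /\<^sub>R t)") (auto simp: perspective_def field_simps)
  also have "\<dots> \<longleftrightarrow>
      (\<forall>y\<in>edom (conjugate f). y \<bullet> x - t * real_of_ereal (conjugate f y) \<le> r)"
  proof -
    have "y \<bullet> (x /\<^sub>R t) - d \<le> r / t \<longleftrightarrow> y \<bullet> x - t * d \<le> r" for y d
    proof -
      have "t * (y \<bullet> (x /\<^sub>R t) - d) = y \<bullet> x - t * d" using t by (simp add: algebra_simps)
      then show ?thesis using t by (metis mult.commute pos_le_divide_eq)
    qed
    then show ?thesis unfolding biconjugate_le_iff[OF f] by simp
  qed
  finally show ?thesis .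
qed

lemma perspective_gt_MInf:
  fixes f :: "'a::euclidean_space \<Rightarrow> ereal"
  assumes f: "closed_epigraph_fun f" and t: "t \<ge> 0"
  shows "perspective f t x > -\<infinity>"
proof -
  obtain y where y: "y \<in> edom (conjugate f)" using edom_conjugate_nonempty[OF f] by blast
  let ?r = "y \<bullet> x - t * real_of_ereal (conjugate f y) - 1"
  have "\<not> perspective f t x \<le> ereal ?r"
    unfolding perspective_le_iff[OF assms] using y by force
  then show ?thesis by (metis MInfty_neq_ereal(1) ereal_infty_less(2) ereal_less_eq(2))
qed

text \<open>The inequalities of \<open>perspective_le_iff\<close> are linear and homogeneous, so
  arbitrary nonnegative weights may combine them: this is sublinearity, not merely
  convexity.\<close>

lemma perspective_convex:
  fixes f :: "'a::euclidean_space \<Rightarrow> ereal"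
  assumes f: "closed_epigraph_fun f"
    and t: "t \<ge> 0" "t' \<ge> 0" and uv: "u \<ge> 0" "v \<ge> 0"
    and le: "perspective f t x \<le> ereal r" "perspective f t' x' \<le> ereal r'"
  shows "perspective f (u * t + v * t') (u *\<^sub>R x + v *\<^sub>R x') \<le> ereal (u * r + v * r')"
proof -
  have tt: "u * t + v * t' \<ge> 0" using t uv by simp
  have *: "u * (y \<bullet> x - t * d) + v * (y \<bullet> x' - t' * d) \<le> u * r + v * r'"
    if "y \<bullet> x - t * d \<le> r" "y \<bullet> x' - t' * d \<le> r'" for y d
    using that uv by (intro add_mono mult_left_mono) auto
  show ?thesis
    unfolding perspective_le_iff[OF f tt]
  proof
    fix y assume y: "y \<in> edom (conjugate f)"
    let ?d = "real_of_ereal (conjugate f y)"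
    have "u * (y \<bullet> x - t * ?d) + v * (y \<bullet> x' - t' * ?d) \<le> u * r + v * r'"
      using y le[unfolded perspective_le_iff[OF f t(1)] perspective_le_iff[OF f t(2)]]
      by (intro *) auto
    then show "y \<bullet> (u *\<^sub>R x + v *\<^sub>R x') - (u * t + v * t') * ?d \<le> u * r + v * r'"
      by (simp add: inner_add_right algebra_simps)
  qed
qed

lemma convex_funD:
  assumes "convex_fun f" "u \<ge> 0" "v \<ge> 0" "u + v = 1"
    and "f x \<le> ereal r" "f x' \<le> ereal r'"
  shows "f (u *\<^sub>R x + v *\<^sub>R x') \<le> ereal (u * r + v * r')"
  using assms(1)[unfolded convex_fun_def, THEN convexD, of "(x, r)" "(x', r')" u v] assms(2-)
  by simp

text \<open>The sum of \<open>(1, z)\<close> and \<open>t\<close> times \<open>(0, v)\<close> again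
  has multiplier 1, so sublinearity of the perspective applies with weights 1 and
  \<open>t\<close>.\<close>

lemma recession_direction:
  fixes f :: "'a::euclidean_space \<Rightarrow> ereal"
  assumes f: "closed_epigraph_fun f" and "perspective f 0 v \<le> 0" "f z \<le> ereal r" "t \<ge> 0"
  shows "f (z + t *\<^sub>R v) \<le> ereal r"
proof -
  have v: "perspective f 0 v \<le> ereal 0" using assms(2) by (simp add: zero_ereal_def)
  have z: "perspective f 1 z \<le> ereal r" using assms(3) by (simp add: perspective_def one_ereal_def[symmetric])
  have "perspective f (1 * 1 + t * 0) (1 *\<^sub>R z + t *\<^sub>R v) \<le> ereal (1 * r + t * 0)"
    by (rule perspective_convex[OF f _ _ _ _ z v]) (use assms in auto)
  then show ?thesis by (simp add: perspective_def one_ereal_def[symmetric])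
qed

text \<open>A nonzero \<open>v\<close> would be a recession direction of every \<open>c l\<close>,
  and a whole ray would remain in the bounded set.\<close>

lemma recession_direction_bounded:
  assumes c: "\<And>l. l \<in> {1..L} \<Longrightarrow> closed_epigraph_fun (c l)"
    and ne: "uncertainty_set L c \<noteq> {}" and bd: "bounded (uncertainty_set L c)"
    and v: "\<And>l. l \<in> {1..L} \<Longrightarrow> perspective (c l) 0 v \<le> 0"
  shows "v = 0"
proof (rule ccontr)
  assume "v \<noteq> 0"
  obtain z where z: "z \<in> uncertainty_set L c" using ne by blast
  obtain B where B: "\<And>x. x \<in> uncertainty_set L c \<Longrightarrow> norm x \<le> B"
    using bd by (auto simp: bounded_iff)
  \<comment> \<open>With this length \<open>t *\<^sub>R v\<close> has norm
    \<open>B + norm z + 1\<close>, one more than the triangle inequality allows.\<close>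
  define t where "t = (B + norm z + 1) / norm v"
  have "B \<ge> 0" using B[OF z] norm_ge_zero order_trans by blast
  then have t: "t \<ge> 0" by (simp add: t_def)
  have "z + t *\<^sub>R v \<in> uncertainty_set L c"
    using recession_direction[OF c v, of _ z 0 t] z t
    by (auto simp: uncertainty_set_def zero_ereal_def)
  then have "norm (z + t *\<^sub>R v) \<le> B" by (rule B)
  moreover have "norm (t *\<^sub>R v) \<le> norm (z + t *\<^sub>R v) + norm z"
    by (metis add_diff_cancel_left' norm_triangle_ineq4)
  moreover have "norm (t *\<^sub>R v) = B + norm z + 1"
    using \<open>v \<noteq> 0\<close> \<open>B \<ge> 0\<close> by (simp add: t_def)
  ultimately show False by simp
qed

section \<open>Partial conjugates of finite saddle functions\<close>

definition finite_saddle_fun :: "('a::euclidean_space \<times> 'b::euclidean_space \<Rightarrow> ereal) \<Rightarrow> bool" where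
  "finite_saddle_fun f \<longleftrightarrow> (\<forall>p. \<bar>f p\<bar> \<noteq> \<infinity>) \<and>
    (\<forall>z. closed_epigraph_fun (\<lambda>x. f (x, z))) \<and> (\<forall>x. closed_epigraph_fun (\<lambda>z. - f (x, z)))"

lemma partial_conjugate_eq: "partial_conjugate f (w, z) = conjugate (\<lambda>x. f (x, z)) w"
  by (simp add: partial_conjugate_def conjugate_def)

lemma partial_conjugate_gt_MInf:
  assumes "finite_saddle_fun f"
  shows "partial_conjugate f p > -\<infinity>"
proof -
  obtain w z where p: "p = (w, z)" by (cases p)
  show ?thesis
    unfolding p partial_conjugate_eq
    using assms by (intro conjugate_gt_MInf) (simp add: finite_saddle_fun_def closed_epigraph_fun_def)
qed

lemma partial_conjugate_le_iff:
  assumes "finite_saddle_fun f"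
  shows "partial_conjugate f (w, z) \<le> ereal r \<longleftrightarrow> (\<forall>x. - f (x, z) \<le> ereal (r - w \<bullet> x))"
proof -
  have "f (x, z) > -\<infinity>" for x
    using assms by (simp add: finite_saddle_fun_def closed_epigraph_fun_def proper_fun_def)
  then have "partial_conjugate f (w, z) \<le> ereal r \<longleftrightarrow> (\<forall>x. ereal (w \<bullet> x - r) \<le> f (x, z))"
    unfolding partial_conjugate_eq by (rule conjugate_le_iff)
  moreover have "ereal (w \<bullet> x - r) \<le> f (x, z) \<longleftrightarrow> - f (x, z) \<le> ereal (r - w \<bullet> x)" for x
    by (cases "f (x, z)") auto
  ultimately show ?thesis by simp
qed

text \<open>The epigraph is the intersection over \<open>x\<close> of linear preimages of the closed
  convex epigraphs of \<open>\<lambda>z. - f (x, z)\<close>, hence closed and convex jointly in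
  \<open>w\<close>, \<open>z\<close> and the height.\<close>

lemma closed_epigraph_partial_conjugate:
  fixes f :: "'a::euclidean_space \<times> 'b::euclidean_space \<Rightarrow> ereal"
  assumes f: "finite_saddle_fun f"
  shows "closed_epigraph_fun (partial_conjugate f)"
proof -
  let ?g = "partial_conjugate f"
  let ?E = "\<lambda>x. {(z, r::real). - f (x, z) \<le> ereal r}"
  let ?T = "\<lambda>x. \<lambda>p::('a \<times> 'b) \<times> real. (snd (fst p), snd p - fst (fst p) \<bullet> x)"
  have epi: "{(p, r::real). ?g p \<le> ereal r} = (\<Inter>x. ?T x -` ?E x)"
    by (auto simp: partial_conjugate_le_iff[OF f])
  have lin: "linear (?T x)" for x
    by (rule linearI) (auto simp: inner_add_left algebra_simps)
  have E: "convex (?E x)" "closed (?E x)" for x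
    using f by (auto simp: finite_saddle_fun_def closed_epigraph_fun_def convex_fun_def)
  have "convex_fun ?g"
    unfolding convex_fun_def epi by (intro convex_INT convex_linear_vimage lin E)
  moreover have "closed {(p, r::real). ?g p \<le> ereal r}"
    unfolding epi
    by (intro closed_INT ballI closed_vimage E linear_continuous_on lin linear_conv_bounded_linear[THEN iffD1])
  moreover have "edom ?g \<noteq> {}"
  proof -
    have "edom (conjugate (\<lambda>x. f (x, 0))) \<noteq> {}"
      using f by (intro edom_conjugate_nonempty) (simp add: finite_saddle_fun_def)
    then obtain w where "w \<in> edom (conjugate (\<lambda>x. f (x, 0)))" by blast
    then have "(w, 0) \<in> edom ?g" by (simp add: edom_def partial_conjugate_eq)
    then show ?thesis by blast
  qed
  ultimately show ?thesis
    using partial_conjugate_gt_MInf[OF f] by (auto simp: closed_epigraph_fun_def proper_fun_def)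
qed

text \<open>As \<open>f\<close> is finite, the Fenchel-Young inequality gives an affine minorant of
  slope \<open>x\<close> for every \<open>x\<close>. Hence the partial perspective at multiplier 0
  is the same for all \<open>z\<close>.\<close>

lemma edom_conjugate_partial_conjugate:
  assumes f: "finite_saddle_fun f"
  shows "edom (conjugate (\<lambda>u. partial_conjugate f (u, z))) = UNIV"
proof -
  have "x \<in> edom (conjugate (\<lambda>u. partial_conjugate f (u, z)))" for x
  proof -
    obtain m where m: "f (x, z) = ereal m"
      using f by (force simp: finite_saddle_fun_def)
    have "ereal (x \<bullet> u + - m) \<le> partial_conjugate f (u, z)" for u
      unfolding partial_conjugate_def using m
      by (auto intro!: SUP_upper2[of x] simp: inner_commute)
    then show ?thesis
      by (intro edom_conjugateI partial_conjugate_gt_MInf[OF f])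
  qed
  then show ?thesis by blast
qed

text \<open>An affine minorant of \<open>\<lambda>z. - f (x, z)\<close> with slope \<open>y\<close>,
  inserted into the Fenchel-Young inequality, yields one of the partial conjugate with slope
  \<open>(x, y)\<close>.\<close>

lemma edom_conjugate_partial_conjugate_fibre:
  assumes f: "finite_saddle_fun f"
  obtains y where "(x, y) \<in> edom (conjugate (partial_conjugate f))"
proof -
  have c: "closed_epigraph_fun (\<lambda>z. - f (x, z))"
    using f by (simp add: finite_saddle_fun_def)
  then have p: "proper_fun (\<lambda>z. - f (x, z))" by (simp add: closed_epigraph_fun_def)
  obtain y where y: "y \<in> edom (conjugate (\<lambda>z. - f (x, z)))"
    using edom_conjugate_nonempty[OF c] by blast
  then obtain b where b: "conjugate (\<lambda>z. - f (x, z)) y = ereal b"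
    using edom_conjugateE[OF p] by blast
  then have *: "ereal (y \<bullet> z - b) \<le> - f (x, z)" for z
    using conjugate_le_iff[of "\<lambda>z. - f (x, z)" y b] p unfolding proper_fun_def by simp
  have "ereal ((x, y) \<bullet> p + - b) \<le> partial_conjugate f p" for p
  proof -
    obtain w z where wz: "p = (w, z)" by (cases p)
    obtain m where m: "f (x, z) = ereal m"
      using f by (force simp: finite_saddle_fun_def)
    have "ereal ((x, y) \<bullet> p + - b) \<le> ereal (w \<bullet> x) - f (x, z)"
      using *[of z] by (simp add: wz m inner_commute)
    also have "\<dots> \<le> partial_conjugate f p"
      unfolding partial_conjugate_def wz by (auto intro!: SUP_upper2[of x])
    finally show ?thesis .
  qed
  then show thesis
    by (intro that edom_conjugateI partial_conjugate_gt_MInf[OF f])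
qed

text \<open>The two perspectives agree because \<open>edom (conjugate (partial_conjugate f))\<close> projects onto the whole space.\<close>

lemma perspective_partial_conjugate_0:
  assumes f: "finite_saddle_fun f"
  shows "perspective (partial_conjugate f) 0 (w, 0) =
    perspective (\<lambda>u. partial_conjugate f (u, z)) 0 w"
proof -
  \<comment> \<open>Pairing with \<open>(w, 0)\<close> sees only the first component of a
    slope.\<close>
  have "(SUP p\<in>edom (conjugate (partial_conjugate f)). ereal (p \<bullet> (w, 0))) =
      (SUP x. ereal (x \<bullet> w))"
  proof (rule antisym)
    show "(SUP p\<in>edom (conjugate (partial_conjugate f)). ereal (p \<bullet> (w, 0))) \<le>
        (SUP x. ereal (x \<bullet> w))"
      by (rule SUP_mono) (auto intro!: exI)
    show "(SUP x. ereal (x \<bullet> w)) \<le>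
        (SUP p\<in>edom (conjugate (partial_conjugate f)). ereal (p \<bullet> (w, 0)))"
    proof (rule SUP_mono)
      fix x
      obtain y where "(x, y) \<in> edom (conjugate (partial_conjugate f))"
        using edom_conjugate_partial_conjugate_fibre[OF f] .
      then show "\<exists>p\<in>edom (conjugate (partial_conjugate f)). ereal (x \<bullet> w) \<le> ereal (p \<bullet> (w, 0))"
        by (intro bexI[of _ "(x, y)"]) auto
    qed
  qed
  then show ?thesis
    by (simp add: perspective_def support_fun_def edom_conjugate_partial_conjugate[OF f])
qed

text \<open>The hypothesis encodes \<open>v = t *\<^sub>R z\<close> for \<open>t \<ge> 0\<close>:
  for \<open>t > 0\<close> the scalings cancel, and for \<open>t = 0\<close> the point
  \<open>z\<close> is arbitrary.\<close>

lemma perspective_partial_conjugate_eq: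
  assumes f: "finite_saddle_fun f" and "t > 0 \<and> z = v /\<^sub>R t \<or> t = 0 \<and> v = 0"
  shows "perspective (partial_conjugate f) t (w, v) =
    perspective (\<lambda>u. partial_conjugate f (u, z)) t w"
  using assms(2)
proof
  assume "t > 0 \<and> z = v /\<^sub>R t"
  then show ?thesis by (simp add: perspective_def)
next
  assume "t = 0 \<and> v = 0"
  then show ?thesis using perspective_partial_conjugate_0[OF f] by simp
qed

section \<open>Comparing maximization problems\<close>

lemma max_value_le:
  assumes "\<And>x. x \<in> X \<Longrightarrow> \<exists>y\<in>Y. g x \<le> h y"
  shows "max_value g X \<le> max_value h Y"
  unfolding max_value_def using assms by (rule SUP_mono)

text \<open>A point dominating an optimal one is optimal when the suprema agree. Infeasible problems
  count as solvable, so infeasibility must carry over too: the common value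
  \<open>-\<infinity>\<close> forces it.\<close>

lemma max_solvable_transfer:
  assumes "\<And>x. x \<in> X \<Longrightarrow> \<exists>y\<in>Y. g x \<le> h y" and eq: "max_value g X = max_value h Y"
    and solv: "max_solvable g X"
  shows "max_solvable h Y"
proof (cases "max_feasible g X = {}")
  case True
  then have "max_value g X \<le> -\<infinity>"
    unfolding max_value_def by (intro SUP_least) (auto simp: max_feasible_def)
  then have "max_value h Y = -\<infinity>" using eq by simp
  then have "h y = -\<infinity>" if "y \<in> Y" for y
    using that SUP_upper[of y Y h] by (simp add: max_value_def)
  then show ?thesis by (auto simp: max_solvable_def max_feasible_def)
next
  case False
  then obtain x where x: "x \<in> X" "g x \<noteq> -\<infinity>" "g x = max_value g X"
    using solv by (auto simp: max_solvable_def max_feasible_def)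
  then obtain y where y: "y \<in> Y" "g x \<le> h y" using assms(1) by blast
  moreover have "h y \<le> max_value h Y" using y by (auto simp: max_value_def intro: SUP_upper)
  ultimately have "h y = max_value h Y" "h y \<noteq> -\<infinity>" using x eq by auto
  then show ?thesis using y by (auto simp: max_solvable_def max_feasible_def)
qed

lemma sum_ereal_gt_MInf:
  fixes b :: "'i \<Rightarrow> ereal"
  assumes "\<And>i. i \<in> A \<Longrightarrow> b i > -\<infinity>"
  shows "(\<Sum>i\<in>A. b i) > -\<infinity>"
  using assms by (induction A rule: infinite_finite_induct) auto

text \<open>Real bounds on the individual terms replace extended arithmetic, so that concavity of
  the objective becomes a matter of real inequalities.\<close>

lemma ereal_le_minus_sum_iff:
  fixes a :: ereal and b :: "'i::finite \<Rightarrow> ereal"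
  assumes "a > -\<infinity>" "\<And>i. b i > -\<infinity>"
  shows "ereal \<rho> \<le> - a - (\<Sum>i\<in>UNIV. b i) \<longleftrightarrow>
    (\<exists>s r. a \<le> ereal s \<and> (\<forall>i. b i \<le> ereal (r i)) \<and> \<rho> \<le> - s - (\<Sum>i\<in>UNIV. r i))"
proof
  assume L: "ereal \<rho> \<le> - a - (\<Sum>i\<in>UNIV. b i)"
  \<comment> \<open>In \<open>ereal\<close>, \<open>-\<infinity> + \<infinity>\<close> is
    \<open>\<infinity>\<close>, so excluding an infinite \<open>a\<close> relies on the sum being
    above \<open>-\<infinity>\<close>.\<close>
  have "a \<noteq> \<infinity>"
  proof
    assume "a = \<infinity>"
    moreover have "(\<Sum>i\<in>UNIV. b i) \<noteq> -\<infinity>"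
      using sum_ereal_gt_MInf[of UNIV b] assms(2) by auto
    ultimately show False using L by (cases "\<Sum>i\<in>UNIV. b i") auto
  qed
  then obtain s where s: "a = ereal s" using assms(1) by (cases a) auto
  have "(\<Sum>i\<in>UNIV. b i) \<noteq> \<infinity>" using L s by auto
  then have "b i \<noteq> \<infinity>" for i by (auto simp: sum_Pinfty)
  then have "\<exists>r. b i = ereal r" for i using assms(2)[of i] by (cases "b i") auto
  then obtain r where r: "\<And>i. b i = ereal (r i)" by metis
  show "\<exists>s r. a \<le> ereal s \<and> (\<forall>i. b i \<le> ereal (r i)) \<and> \<rho> \<le> - s - (\<Sum>i\<in>UNIV. r i)"
    using L by (intro exI[of _ s] exI[of _ r]) (simp add: s r)
next
  assume "\<exists>s r. a \<le> ereal s \<and> (\<forall>i. b i \<le> ereal (r i)) \<and> \<rho> \<le> - s - (\<Sum>i\<in>UNIV. r i)"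
  then obtain s r where sr: "a \<le> ereal s" "\<And>i. b i \<le> ereal (r i)"
    "\<rho> \<le> - s - (\<Sum>i\<in>UNIV. r i)" by blast
  have "ereal \<rho> \<le> - ereal s - (\<Sum>i\<in>UNIV. ereal (r i))" using sr(3) by simp
  also have "\<dots> \<le> - a - (\<Sum>i\<in>UNIV. b i)"
    using sr by (intro ereal_minus_mono sum_mono) (simp_all only: ereal_minus_le_minus)
  finally show "ereal \<rho> \<le> - a - (\<Sum>i\<in>UNIV. b i)" .
qed

text \<open>Only the real bounds pass to the limit as \<open>\<theta>\<close> tends to 0 from the
  right, so no semicontinuity of the objective has to be invoked.\<close>

lemma ereal_le_of_convex_combination:
  fixes m :: ereal and R S :: real
  assumes "\<And>\<theta>. 0 < \<theta> \<Longrightarrow> \<theta> < 1 \<Longrightarrow> ereal ((1 - \<theta>) * R + \<theta> * S) \<le> m"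
  shows "ereal R \<le> m"
proof (rule tendsto_upperbound)
  have "((\<lambda>\<theta>. (1 - \<theta>) * R + \<theta> * S) \<longlongrightarrow> (1 - 0) * R + 0 * S) (at_right 0)"
    by (intro tendsto_intros)
  then show "((\<lambda>\<theta>. ereal ((1 - \<theta>) * R + \<theta> * S)) \<longlongrightarrow> ereal R) (at_right 0)" by simp
  show "\<forall>\<^sub>F \<theta> in at_right 0. ereal ((1 - \<theta>) * R + \<theta> * S) \<le> m"
    using eventually_at_right_real[OF zero_less_one] by (rule eventually_mono) (auto intro: assms)
qed simp

section \<open>The two dual problems\<close>

context
  fixes L :: nat
    and c :: "nat \<Rightarrow> 'b::euclidean_space \<Rightarrow> ereal"
    and f :: "'i::finite option \<Rightarrow> 'a::euclidean_space \<times> 'b \<Rightarrow> ereal"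
  assumes c: "\<And>l. l \<in> {1..L} \<Longrightarrow> closed_epigraph_fun (c l)"
    and f: "\<And>i. finite_saddle_fun (f i)"
begin

text \<open>The embedding scales \<open>z $ Some i\<close> by \<open>lam $ i\<close>. The
  perspectives agree under it, also at a zero multiplier, so the objective value is preserved
  exactly.\<close>

lemma DB_to_DB':
  assumes "(w, z, lam) \<in> DB_set L c"
  shows "(w, z $ None, lam, \<chi> i. lam $ i *\<^sub>R z $ Some i) \<in> DB'_set L c"
    and "DB'_obj f (w, z $ None, lam, \<chi> i. lam $ i *\<^sub>R z $ Some i) = DB_obj f (w, z, lam)"
proof -
  have lam: "lam $ i \<ge> 0" for i using assms by (simp add: DB_set_def)
  have z: "c l (z $ i) \<le> 0" if "l \<in> {1..L}" for l i
    using assms that by (auto simp: DB_set_def uncertainty_set_def)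
  have "perspective (c l) (lam $ i) (lam $ i *\<^sub>R z $ Some i) \<le> 0" if "l \<in> {1..L}" for l i
  proof (cases "lam $ i = 0")
    case True
    \<comment> \<open>At a zero multiplier the constraint is a support function evaluated at 0, a
      supremum of zeros.\<close>
    then show ?thesis by (simp add: perspective_def support_fun_def SUP_le_iff zero_ereal_def)
  next
    case False
    then have "lam $ i > 0" using lam[of i] by simp
    then show ?thesis using z[OF that, of "Some i"]
      by (cases "c l (z $ Some i)") (auto simp: perspective_def mult_nonneg_nonpos)
  qed
  then show "(w, z $ None, lam, \<chi> i. lam $ i *\<^sub>R z $ Some i) \<in> DB'_set L c"
    using assms z by (auto simp: DB'_set_def DB_set_def)
  have "perspective (partial_conjugate (f (Some i))) (lam $ i) (w $ Some i, lam $ i *\<^sub>R z $ Some i)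
      = perspective (\<lambda>u. partial_conjugate (f (Some i)) (u, z $ Some i)) (lam $ i) (w $ Some i)" for i
    by (rule perspective_partial_conjugate_eq[OF f]) (use lam[of i] in auto)
  then show "DB'_obj f (w, z $ None, lam, \<chi> i. lam $ i *\<^sub>R z $ Some i) = DB_obj f (w, z, lam)"
    by (simp add: DB'_obj_def DB_obj_def)
qed

text \<open>Division by the positive multipliers inverts the embedding; the assumption on zero
  multipliers says that the point lies in its image.\<close>

lemma DB'_to_DB:
  assumes ne: "uncertainty_set L c \<noteq> {}" and p: "(w, z\<^sub>0, lam, v) \<in> DB'_set L c"
    and v: "\<And>i. lam $ i = 0 \<Longrightarrow> v $ i = 0"
  shows "\<exists>q\<in>DB_set L c. DB_obj f q = DB'_obj f (w, z\<^sub>0, lam, v)"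
proof -
  obtain z1 where z1: "z1 \<in> uncertainty_set L c" using ne by blast
  \<comment> \<open>At a zero multiplier any point \<open>z1\<close> of the uncertainty set serves:
    it satisfies the constraints, and the partial perspective at 0 is the same for every
    choice.\<close>
  define zi where "zi i = (if lam $ i = 0 then z1 else v $ i /\<^sub>R lam $ i)" for i
  define z :: "'b ^ 'i option" where "z = (\<chi> j. case j of None \<Rightarrow> z\<^sub>0 | Some i \<Rightarrow> zi i)"
  have z: "z $ None = z\<^sub>0" "\<And>i. z $ Some i = zi i" by (simp_all add: z_def)
  have lam: "lam $ i \<ge> 0" for i using p by (simp add: DB'_set_def)
  have "zi i \<in> uncertainty_set L c" for i
  proof (cases "lam $ i = 0")
    case False
    then have pos: "lam $ i > 0" using lam[of i] by simp
    have "c l (v $ i /\<^sub>R lam $ i) \<le> 0" if "l \<in> {1..L}" for l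
    proof -
      have "perspective (c l) (lam $ i) (v $ i) \<le> 0" using p that by (auto simp: DB'_set_def)
      then show ?thesis using pos
        by (cases "c l (v $ i /\<^sub>R lam $ i)") (auto simp: perspective_def mult_le_0_iff)
    qed
    then show ?thesis using False by (simp add: zi_def uncertainty_set_def)
  qed (simp add: zi_def z1)
  moreover have "z\<^sub>0 \<in> uncertainty_set L c" using p by (simp add: DB'_set_def uncertainty_set_def)
  ultimately have "z $ j \<in> uncertainty_set L c" for j by (cases j) (simp_all add: z)
  then have "(w, z, lam) \<in> DB_set L c" using p by (simp add: DB'_set_def DB_set_def)
  moreover have "perspective (partial_conjugate (f (Some i))) (lam $ i) (w $ Some i, v $ i)
      = perspective (\<lambda>u. partial_conjugate (f (Some i)) (u, z $ Some i)) (lam $ i) (w $ Some i)" for i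
    by (rule perspective_partial_conjugate_eq[OF f])
      (use lam[of i] v[of i] in \<open>auto simp: z zi_def\<close>)
  then have "DB_obj f (w, z, lam) = DB'_obj f (w, z\<^sub>0, lam, v)"
    by (simp add: DB'_obj_def DB_obj_def z)
  ultimately show ?thesis by blast
qed

section \<open>Joint concavity of (D-B')\<close>

lemma DB'_obj_ge_iff:
  assumes "(w, z\<^sub>0, lam, v) \<in> DB'_set L c"
  shows "ereal \<rho> \<le> DB'_obj f (w, z\<^sub>0, lam, v) \<longleftrightarrow>
    (\<exists>s r. partial_conjugate (f None) (w $ None, z\<^sub>0) \<le> ereal s \<and>
      (\<forall>i. perspective (partial_conjugate (f (Some i))) (lam $ i) (w $ Some i, v $ i) \<le> ereal (r i)) \<and>
      \<rho> \<le> - s - (\<Sum>i\<in>UNIV. r i))"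
proof -
  have lam: "lam $ i \<ge> 0" for i using assms by (simp add: DB'_set_def)
  show ?thesis
    unfolding DB'_obj_def case_prod_conv
    by (intro ereal_le_minus_sum_iff partial_conjugate_gt_MInf f perspective_gt_MInf
        closed_epigraph_partial_conjugate lam)
qed

lemma DB'_set_convex:
  assumes p: "p \<in> DB'_set L c" and q: "q \<in> DB'_set L c" and \<theta>: "u \<ge> 0" "v \<ge> 0" "u + v = 1"
  shows "u *\<^sub>R p + v *\<^sub>R q \<in> DB'_set L c"
proof -
  obtain w z\<^sub>0 lam y where pp: "p = (w, z\<^sub>0, lam, y)" by (cases p)
  obtain w' z\<^sub>0' lam' y' where qq: "q = (w', z\<^sub>0', lam', y')" by (cases q)
  have "c l (u *\<^sub>R z\<^sub>0 + v *\<^sub>R z\<^sub>0') \<le> 0" if "l \<in> {1..L}" for l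
    using convex_funD[of "c l" u v z\<^sub>0 0 z\<^sub>0' 0] c[OF that] p q that \<theta>
    by (auto simp: closed_epigraph_fun_def DB'_set_def pp qq zero_ereal_def)
  moreover have "perspective (c l) (u * lam $ i + v * lam' $ i) (u *\<^sub>R y $ i + v *\<^sub>R y' $ i) \<le> 0"
    if "l \<in> {1..L}" for l i
    using perspective_convex[OF c[OF that], of "lam $ i" "lam' $ i" u v "y $ i" 0 "y' $ i" 0] p q that \<theta>
    by (auto simp: DB'_set_def pp qq zero_ereal_def)
  moreover have "(\<Sum>i\<in>UNIV. u *\<^sub>R w $ i + v *\<^sub>R w' $ i) = 0"
    using p q by (simp add: sum.distrib scaleR_sum_right[symmetric] DB'_set_def pp qq)
  ultimately show ?thesis
    using p q \<theta> by (auto simp: DB'_set_def pp qq)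
qed

text \<open>The real lower bounds \<open>R\<close> and \<open>S\<close> split into real bounds on
  each term, and these combine by convexity of the partial conjugate and joint convexity of the
  perspectives.\<close>

lemma DB'_obj_concave:
  assumes p: "p \<in> DB'_set L c" and q: "q \<in> DB'_set L c" and \<theta>: "u \<ge> 0" "v \<ge> 0" "u + v = 1"
    and R: "ereal R \<le> DB'_obj f p" and S: "ereal S \<le> DB'_obj f q"
  shows "ereal (u * R + v * S) \<le> DB'_obj f (u *\<^sub>R p + v *\<^sub>R q)"
proof -
  obtain w z\<^sub>0 lam y where pp: "p = (w, z\<^sub>0, lam, y)" by (cases p)
  obtain w' z\<^sub>0' lam' y' where qq: "q = (w', z\<^sub>0', lam', y')" by (cases q)
  have g: "closed_epigraph_fun (partial_conjugate (f i))" for i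
    by (rule closed_epigraph_partial_conjugate[OF f])
  obtain s r where 1: "partial_conjugate (f None) (w $ None, z\<^sub>0) \<le> ereal s"
    "\<And>i. perspective (partial_conjugate (f (Some i))) (lam $ i) (w $ Some i, y $ i) \<le> ereal (r i)"
    "R \<le> - s - (\<Sum>i\<in>UNIV. r i)"
    using R p unfolding pp by (auto simp: DB'_obj_ge_iff)
  obtain s' r' where 2: "partial_conjugate (f None) (w' $ None, z\<^sub>0') \<le> ereal s'"
    "\<And>i. perspective (partial_conjugate (f (Some i))) (lam' $ i) (w' $ Some i, y' $ i) \<le> ereal (r' i)"
    "S \<le> - s' - (\<Sum>i\<in>UNIV. r' i)"
    using S q unfolding qq by (auto simp: DB'_obj_ge_iff)
  have lam: "lam $ i \<ge> 0" "lam' $ i \<ge> 0" for i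
    using p q by (auto simp: DB'_set_def pp qq)
  have 3: "partial_conjugate (f None) (u *\<^sub>R (w $ None, z\<^sub>0) + v *\<^sub>R (w' $ None, z\<^sub>0')) \<le>
      ereal (u * s + v * s')"
    using g \<theta> 1 2 by (intro convex_funD) (auto simp: closed_epigraph_fun_def)
  have 4: "perspective (partial_conjugate (f (Some i))) (u * lam $ i + v * lam' $ i)
      (u *\<^sub>R (w $ Some i, y $ i) + v *\<^sub>R (w' $ Some i, y' $ i)) \<le> ereal (u * r i + v * r' i)" for i
    using g lam \<theta> 1 2 by (intro perspective_convex) auto
  have 5: "u * R + v * S \<le> - (u * s + v * s') - (\<Sum>i\<in>UNIV. u * r i + v * r' i)"
    using mult_left_mono[OF 1(3) \<theta>(1)] mult_left_mono[OF 2(3) \<theta>(2)]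
    by (simp add: sum.distrib sum_distrib_left[symmetric] algebra_simps)
  have "(u *\<^sub>R w + v *\<^sub>R w', u *\<^sub>R z\<^sub>0 + v *\<^sub>R z\<^sub>0', u *\<^sub>R lam + v *\<^sub>R lam', u *\<^sub>R y + v *\<^sub>R y') \<in> DB'_set L c"
    using DB'_set_convex[OF p q \<theta>] by (simp add: pp qq)
  from DB'_obj_ge_iff[OF this, of "u * R + v * S"] 3 4 5 show ?thesis
    by (auto simp: pp qq intro!: exI)
qed

text \<open>Every subtracted term exceeds \<open>-\<infinity>\<close>. Objective values other than
  \<open>-\<infinity>\<close> are therefore real.\<close>

lemma DB'_obj_less_PInf:
  assumes "p \<in> DB'_set L c"
  shows "DB'_obj f p < \<infinity>"
proof (rule ccontr)
  assume "\<not> DB'_obj f p < \<infinity>"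
  then have top: "DB'_obj f p = \<infinity>" by simp
  obtain w z\<^sub>0 lam y where pp: "p = (w, z\<^sub>0, lam, y)" by (cases p)
  let ?a = "partial_conjugate (f None) (w $ None, z\<^sub>0)"
  let ?b = "\<lambda>i. perspective (partial_conjugate (f (Some i))) (lam $ i) (w $ Some i, y $ i)"
  have lam: "lam $ i \<ge> 0" for i using assms by (simp add: DB'_set_def pp)
  have "?a > -\<infinity>" "(\<Sum>i\<in>UNIV. ?b i) > -\<infinity>"
    by (intro partial_conjugate_gt_MInf f sum_ereal_gt_MInf perspective_gt_MInf
        closed_epigraph_partial_conjugate lam)+
  then have "- ?a - (\<Sum>i\<in>UNIV. ?b i) \<noteq> \<infinity>"
    by (cases ?a; cases "\<Sum>i\<in>UNIV. ?b i") auto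
  then show False using top by (simp add: DB'_obj_def pp)
qed

text \<open>Moving from \<open>p\<close> slightly towards the image \<open>q\<close> of the given
  point makes all multipliers positive, so the moved point comes from (D-B) with the same value. By
  concavity this value is at least the convex combination of those at \<open>p\<close> and
  \<open>q\<close>, which tends to the value at \<open>p\<close>.\<close>

lemma max_value_DB'_le_of_positive_multipliers:
  assumes ne: "uncertainty_set L c \<noteq> {}" and q: "(w', z', lam') \<in> DB_set L c"
    and pos: "\<And>i. lam' $ i > 0" and fin: "DB_obj f (w', z', lam') \<noteq> -\<infinity>"
  shows "max_value (DB'_obj f) (DB'_set L c) \<le> max_value (DB_obj f) (DB_set L c)"
  unfolding max_value_def[of "DB'_obj f"]
proof (rule SUP_least)
  fix p :: "('a, 'b, 'i) DB'_var"
  assume p: "p \<in> DB'_set L c"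
  define q where "q = (w', z' $ None, lam', \<chi> i. lam' $ i *\<^sub>R z' $ Some i)"
  have q': "q \<in> DB'_set L c" "DB'_obj f q \<noteq> -\<infinity>"
    using DB_to_DB'[OF q] fin by (simp_all add: q_def)
  show "DB'_obj f p \<le> max_value (DB_obj f) (DB_set L c)"
  proof (cases "DB'_obj f p = -\<infinity>")
    case False
    then obtain R where R: "DB'_obj f p = ereal R"
      using DB'_obj_less_PInf[OF p] by (cases "DB'_obj f p") auto
    obtain S where S: "DB'_obj f q = ereal S"
      using DB'_obj_less_PInf[OF q'(1)] q'(2) by (cases "DB'_obj f q") auto
    have "ereal ((1 - \<theta>) * R + \<theta> * S) \<le> max_value (DB_obj f) (DB_set L c)"
      if \<theta>: "0 < \<theta>" "\<theta> < 1" for \<theta>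
    proof -
      obtain w z\<^sub>0 lam y where m: "(1 - \<theta>) *\<^sub>R p + \<theta> *\<^sub>R q = (w, z\<^sub>0, lam, y)"
        by (metis surj_pair)
      have "(1 - \<theta>) *\<^sub>R p + \<theta> *\<^sub>R q \<in> DB'_set L c"
        by (rule DB'_set_convex) (use p q' \<theta> in auto)
      then have mem: "(w, z\<^sub>0, lam, y) \<in> DB'_set L c" by (simp add: m)
      have "lam $ i \<noteq> 0" for i
      proof -
        have "lam $ i = (1 - \<theta>) * fst (snd (snd p)) $ i + \<theta> * lam' $ i"
          using arg_cong[OF m, of "\<lambda>m. fst (snd (snd m)) $ i"] by (simp add: q_def)
        moreover have "fst (snd (snd p)) $ i \<ge> 0" using p by (auto simp: DB'_set_def)
        ultimately have "lam $ i > 0" using \<theta> pos[of i] by (simp add: add_nonneg_pos)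
        then show ?thesis by simp
      qed
      then obtain d where d: "d \<in> DB_set L c" "DB_obj f d = DB'_obj f (w, z\<^sub>0, lam, y)"
        using DB'_to_DB[OF ne mem] by blast
      have "ereal ((1 - \<theta>) * R + \<theta> * S) \<le> DB'_obj f ((1 - \<theta>) *\<^sub>R p + \<theta> *\<^sub>R q)"
        by (rule DB'_obj_concave) (use p q' \<theta> R S in auto)
      also have "\<dots> = DB_obj f d" by (simp add: m d)
      also have "\<dots> \<le> max_value (DB_obj f) (DB_set L c)"
        unfolding max_value_def using d by (intro SUP_upper)
      finally show ?thesis .
    qed
    then show ?thesis unfolding R by (rule ereal_le_of_convex_combination)
  qed simp
qed

end

theorem proposition5:
  fixes L :: nat
    and c :: "nat \<Rightarrow> 'b::euclidean_space \<Rightarrow> ereal"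
    and f :: "'i::finite option \<Rightarrow> 'a::euclidean_space \<times> 'b \<Rightarrow> ereal"
  assumes "uncertainty_set L c \<noteq> {}"
    and "\<And>l. l \<in> {1..L} \<Longrightarrow> proper_fun (c l) \<and> closed_fun (c l) \<and> convex_fun (c l)"
    and "\<And>i z. proper_fun (\<lambda>x. f i (x, z)) \<and> closed_fun (\<lambda>x. f i (x, z)) \<and>
                convex_fun (\<lambda>x. f i (x, z))"
    and "\<And>i x. proper_fun (\<lambda>z. - f i (x, z)) \<and> closed_fun (\<lambda>z. - f i (x, z)) \<and>
                convex_fun (\<lambda>z. - f i (x, z))"
  shows
    "max_value (DB_obj f) (DB_set L c) \<le> max_value (DB'_obj f) (DB'_set L c)
     \<and> ((\<exists>x. max_strict_slater_point (DB_obj f) (DB_ineqs L c) DB_eqs x) \<longrightarrow>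
          max_value (DB_obj f) (DB_set L c) = max_value (DB'_obj f) (DB'_set L c) \<and>
          (max_solvable (DB_obj f) (DB_set L c) \<longrightarrow> max_solvable (DB'_obj f) (DB'_set L c)))
     \<and> (bounded (uncertainty_set L c) \<longrightarrow>
          max_value (DB_obj f) (DB_set L c) = max_value (DB'_obj f) (DB'_set L c) \<and>
          (max_solvable (DB'_obj f) (DB'_set L c) \<longleftrightarrow> max_solvable (DB_obj f) (DB_set L c)))"
proof -
  have c: "closed_epigraph_fun (c l)" if "l \<in> {1..L}" for l
    using assms(2)[OF that] by (auto intro: closed_epigraph_funI)
  have f: "finite_saddle_fun (f i)" for i
  proof -
    have "\<bar>f i (x, z)\<bar> \<noteq> \<infinity>" for x z
    proof -
      have "f i (x, z) > -\<infinity>" "- f i (x, z) > -\<infinity>"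
        using assms(3)[of i z] assms(4)[of i x] by (simp_all add: proper_fun_def)
      then show ?thesis by (cases "f i (x, z)") auto
    qed
    moreover have "closed_epigraph_fun (\<lambda>x. f i (x, z))" for z
      using assms(3)[of i z] by (intro closed_epigraph_funI) simp_all
    moreover have "closed_epigraph_fun (\<lambda>z. - f i (x, z))" for x
      using assms(4)[of i x] by (intro closed_epigraph_funI) simp_all
    ultimately show ?thesis by (simp add: finite_saddle_fun_def split_paired_all)
  qed
  have fwd: "\<exists>q\<in>DB'_set L c. DB_obj f p \<le> DB'_obj f q" if "p \<in> DB_set L c" for p
  proof -
    obtain w z lam where p: "p = (w, z, lam)" by (cases p)
    show ?thesis
      using DB_to_DB'[of L c f, OF c f that[unfolded p]] by (intro bexI) (auto simp: p)
  qed
  have i: "max_value (DB_obj f) (DB_set L c) \<le> max_value (DB'_obj f) (DB'_set L c)"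
    using fwd by (rule max_value_le)
  have ii: "max_value (DB_obj f) (DB_set L c) = max_value (DB'_obj f) (DB'_set L c)"
    if "max_strict_slater_point (DB_obj f) (DB_ineqs L c) DB_eqs x" for x
  proof -
    obtain w z lam where x: "x = (w, z, lam)" by (cases x)
    have slater: "x \<in> DB_set L c" "\<And>g. g \<in> DB_ineqs L c \<Longrightarrow> g x < 0"
      "x \<in> rel_interior (edom (\<lambda>y. - DB_obj f y))"
      using that unfolding max_strict_slater_point_def strict_slater_point_def slater_point_def
        DB_set_eq_constraint_set by auto
    \<comment> \<open>Strictness for the constraint \<open>- (lam $ i) \<le> 0\<close> makes the
      multipliers positive.\<close>
    have "lam $ i > 0" for i
      using slater(2)[of "\<lambda>(w, z, lam). ereal (- (lam $ i))"]
      by (auto simp: DB_ineqs_def x zero_ereal_def)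
    \<comment> \<open>The relative interior lies in the domain, so the Slater point has a value
      above \<open>-\<infinity>\<close>.\<close>
    moreover have "DB_obj f x \<noteq> -\<infinity>"
      using slater(3) rel_interior_subset by (fastforce simp: edom_def)
    ultimately have "max_value (DB'_obj f) (DB'_set L c) \<le> max_value (DB_obj f) (DB_set L c)"
      using max_value_DB'_le_of_positive_multipliers[of L c f, OF c f assms(1)] slater(1) x by blast
    then show ?thesis using i by simp
  qed
  have bwd: "\<exists>q\<in>DB_set L c. DB'_obj f p \<le> DB_obj f q"
    if bd: "bounded (uncertainty_set L c)" and p: "p \<in> DB'_set L c" for p
  proof -
    obtain w z\<^sub>0 lam v where pp: "p = (w, z\<^sub>0, lam, v)" by (cases p)
    have "perspective (c l) (lam $ i) (v $ i) \<le> 0" if "l \<in> {1..L}" for l i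
      using p that by (simp add: DB'_set_def pp)
    \<comment> \<open>By boundedness a zero multiplier leaves only the zero recession direction, so
      every point satisfying the constraints lies in the image of the embedding.\<close>
    then have "v $ i = 0" if "lam $ i = 0" for i
      using that recession_direction_bounded[of L c, OF c assms(1) bd, of "v $ i"] by metis
    then show ?thesis
      using DB'_to_DB[of L c f, OF c f assms(1) p[unfolded pp]] unfolding pp by force
  qed
  have iii: "max_value (DB_obj f) (DB_set L c) = max_value (DB'_obj f) (DB'_set L c)"
    if "bounded (uncertainty_set L c)"
    using i max_value_le[of "DB'_set L c" "DB_set L c" "DB'_obj f" "DB_obj f"] bwd[OF that]
    by (auto intro: antisym)
  have solv: "max_solvable (DB_obj f) (DB_set L c) \<Longrightarrow> max_solvable (DB'_obj f) (DB'_set L c)"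
    if "max_value (DB_obj f) (DB_set L c) = max_value (DB'_obj f) (DB'_set L c)"
    using max_solvable_transfer[OF fwd that] .
  have solv': "max_solvable (DB'_obj f) (DB'_set L c) \<Longrightarrow> max_solvable (DB_obj f) (DB_set L c)"
    if "bounded (uncertainty_set L c)"
    using max_solvable_transfer[OF bwd[OF that] iii[OF that, symmetric]] .
  show ?thesis
    using i ii iii solv solv' by blast
qed

end
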